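(* Let $C$ be a $d$-variate Archimedean copula with generator $\phi$ and let $(U_1,\ldots,U_d)$ have distribution function $C$. Suppose that $\phi'(1)=0$ and that $$-\lim_{s\downarrow 0}\frac{s\,\phi'(1-s)}{\phi(1-s)}=1.$$ Then the function $s\mapsto\ell(s)=s^{-1}\phi(1-s)$ is increasing and slowly varying at zero, and for $(x_1,\ldots,x_d)\in(0,1]^d$, $$\lim_{s\downarrow 0}\Pr[U_1>1-s x_1;\ \forall j=2,\ldots,d: U_j\leq 1-\eta_s(x_j)\mid U_1>1-s]=x_1\min(x_2,\ldots,x_d),$$ where $\eta_s(x)=\ell^{\leftarrow}(x^{-1}\ell(s))$, a function which has the following properties: (i) $\lim_{s\downarrow 0}\eta_s(x)=0$ for all $0<x<\infty$; (ii) $\lim_{s\downarrow 0}s/\eta_s(x)=0$ for all $0<x<1$.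
   Context: Fix an integer $d\geq 2$. An Archimedean generator is a convex, decreasing function $\phi:[0,1]\to[0,\infty]$ with $\phi(1)=0$; its generalized inverse is $\phi^{\leftarrow}(y)=\inf\{t\in[0,1]:\phi(t)\leq y\}$ for $y\in[0,\infty]$. The Archimedean copula with generator $\phi$ is $C(u_1,\ldots,u_d)=\phi^{\leftarrow}(\phi(u_1)+\cdots+\phi(u_d))$ on $[0,1]^d$; it is assumed throughout that $C$ is indeed a copula, i.e. (the restriction to $[0,1]^d$ of) a distribution function with uniform$(0,1)$ margins (equivalently, $\phi^{\leftarrow}$ is $d$-monotone on $(0,\infty)$). $\phi'$ denotes a non-decreasing version of the Radon-Nikodym derivative of $\phi$, and $\phi'(1)=-\lim_{s\downarrow 0}\phi(1-s)/s$. A positive measurable function $f$ on a right neighbourhood of zero is slowly varying at zero if $f(sx)/f(s)\to 1$ as $s\downarrow 0$ for every $x>0$. $\ell^{\leftarrow}$ denotes the inverse function of the increasing function $\ell$; for fixed $x$, $\eta_s(x)$ is considered for $s>0$ small enough that $x^{-1}\ell(s)$ lies in the range of $\ell$. *)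

theory Defs
  imports "HOL-Probability.Probability"
begin

section \<open>Archimedean generators\<close>

text \<open>Only monotonicity in the weak sense is required here: for a generator of a copula, strict
  monotonicity and finiteness on \<open>(0,1]\<close> follow from the uniform margins. The value
  \<open>\<phi> 0 = \<infinity>\<close> is allowed, and \<open>\<phi>\<close> is only relevant on \<open>[0,1]\<close>.\<close>

definition archimedean_generator :: "(real \<Rightarrow> ennreal) \<Rightarrow> bool" where
  "archimedean_generator \<phi> \<longleftrightarrow>
     antimono_on {0..1} \<phi> \<and>
     (\<forall>x\<in>{0..1}. \<forall>y\<in>{0..1}. \<forall>t\<in>{0..1}.
        \<phi> ((1 - t) * x + t * y) \<le> ennreal (1 - t) * \<phi> x + ennreal t * \<phi> y) \<and>
     \<phi> 1 = 0"

definition generator_inverse :: "(real \<Rightarrow> ennreal) \<Rightarrow> ennreal \<Rightarrow> real" where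
  "generator_inverse \<phi> y = Inf {t \<in> {0..1}. \<phi> t \<le> y}"

text \<open>\<open>\<phi>'\<close> is a non-decreasing version of the Radon-Nikodym derivative of \<open>\<phi>\<close> on
  \<open>(0,1)\<close>, extended to the point \<open>1\<close> by \<open>\<phi>'(1) = - lim \<phi>(1 - s) / s\<close>.
  The conversion \<open>enn2real\<close> is harmless, as generators of copulas are finite on \<open>(0,1]\<close>.\<close>

definition generator_derivative :: "(real \<Rightarrow> ennreal) \<Rightarrow> (real \<Rightarrow> real) \<Rightarrow> bool" where
  "generator_derivative \<phi> \<phi>' \<longleftrightarrow>
     mono_on {0<..<1} \<phi>' \<and>
     (\<forall>u v. 0 < u \<longrightarrow> u \<le> v \<longrightarrow> v < 1 \<longrightarrow>
        set_integrable lborel {u..v} \<phi>' \<and>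
        (LBINT t:{u..v}. \<phi>' t) = enn2real (\<phi> v) - enn2real (\<phi> u)) \<and>
     ((\<lambda>s. enn2real (\<phi> (1 - s)) / s) \<longlongrightarrow> - \<phi>' 1) (at_right 0)"


section \<open>Copulas\<close>

text \<open>The coordinates of \<open>d\<close>-dimensional vectors are indexed by \<open>{1..d}\<close>. The joint
  distribution function is prescribed on \<open>[0,1]\<^sup>d\<close> only; if \<open>C\<close> is a copula, this
  determines the law of the vector, since \<open>C = 1\<close> at \<open>(1,\<dots>,1)\<close> and \<open>C = 0\<close> as
  soon as one argument vanishes.\<close>

definition has_df_on_unit_cube ::
    "'a measure \<Rightarrow> nat \<Rightarrow> (nat \<Rightarrow> 'a \<Rightarrow> real) \<Rightarrow> ((nat \<Rightarrow> real) \<Rightarrow> real) \<Rightarrow> bool" where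
  "has_df_on_unit_cube M d U C \<longleftrightarrow>
     (\<forall>i\<in>{1..d}. U i \<in> borel_measurable M) \<and>
     (\<forall>u. (\<forall>i\<in>{1..d}. u i \<in> {0..1}) \<longrightarrow>
        \<P>(\<omega> in M. \<forall>i\<in>{1..d}. U i \<omega> \<le> u i) = C u)"

definition is_copula :: "nat \<Rightarrow> ((nat \<Rightarrow> real) \<Rightarrow> real) \<Rightarrow> bool" where
  "is_copula d C \<longleftrightarrow>
     (\<exists>\<mu> :: (nat \<Rightarrow> real) measure.
        prob_space \<mu> \<and>
        sets \<mu> = sets (Pi\<^sub>M {1..d} (\<lambda>_. borel)) \<and>
        (\<forall>i\<in>{1..d}. distr \<mu> borel (\<lambda>x. x i) = uniform_measure lborel {0<..<1}) \<and>
        has_df_on_unit_cube \<mu> d (\<lambda>i x. x i) C)"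

definition archimedean_copula :: "nat \<Rightarrow> (real \<Rightarrow> ennreal) \<Rightarrow> (nat \<Rightarrow> real) \<Rightarrow> real" where
  "archimedean_copula d \<phi> u = generator_inverse \<phi> (\<Sum>i\<in>{1..d}. \<phi> (u i))"


section \<open>Slow variation and the functions \<open>\<ell>\<close> and \<open>\<eta>\<close>\<close>

definition slowly_varying_at_zero :: "(real \<Rightarrow> real) \<Rightarrow> bool" where
  "slowly_varying_at_zero f \<longleftrightarrow>
     (\<exists>\<delta>>0. (\<forall>s\<in>{0<..<\<delta>}. 0 < f s) \<and> f \<in> borel_measurable (restrict_space borel {0<..<\<delta>})) \<and>
     (\<forall>x>0. ((\<lambda>s. f (s * x) / f s) \<longlongrightarrow> 1) (at_right 0))"

text \<open>\<open>ell \<phi>\<close> is considered on \<open>(0,1]\<close>; it is extended-valued because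
  \<open>ell \<phi> 1 = \<phi> 0\<close> may be infinite.\<close>

definition ell :: "(real \<Rightarrow> ennreal) \<Rightarrow> real \<Rightarrow> ennreal" where
  "ell \<phi> s = \<phi> (1 - s) / ennreal s"

text \<open>Meaningful if \<open>ell \<phi>\<close> is injective on \<open>(0,1]\<close> and \<open>ell \<phi> s / x\<close> is in its
  range.\<close>

definition eta :: "(real \<Rightarrow> ennreal) \<Rightarrow> real \<Rightarrow> real \<Rightarrow> real" where
  "eta \<phi> s x = the_inv_into {0<..1} (ell \<phi>) (ell \<phi> s / ennreal x)"

end

theory Submission
  imports Defs
begin

text \<open>
  Put \<open>g s = \<phi> (1 - s)\<close>, a convex function with \<open>g 0 = 0\<close>, and \<open>L s = g s / s\<close>. Convexity
  makes \<open>L\<close> non-decreasing, and strictly so because \<open>L\<close> tends to \<open>0\<close> at \<open>0\<close>. For \<open>x < 1\<close>,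
  the subgradient bound \<open>g s - g (s x) \<le> (1 - x) s g' s\<close> and the hypothesis
  \<open>s g' s / g s \<rightarrow> 1\<close> give \<open>lim inf g (s x) / g s \<ge> x\<close>, while \<open>g (s x) \<le> x g s\<close> by convexity;
  so \<open>L\<close> varies slowly. The properties of \<open>\<eta>\<close> follow by applying \<open>L\<close> to the inequalities.

  The conditional probability equals \<open>(z - y) / s\<close> with \<open>g y = (\<Sum>j\<ge>2. g (\<eta> s (x j)))\<close> and
  \<open>g z = g y + g (s x\<^sub>1)\<close>. If \<open>m\<close> is the minimum of the \<open>x j\<close>, then \<open>E = \<eta> s m\<close> is the largest
  of the \<open>\<eta> s (x j)\<close>, hence \<open>E \<le> y < z \<le> d E\<close>. By convexity the slope of \<open>g\<close> between \<open>y\<close> and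
  \<open>z\<close> lies between \<open>L E\<close> and \<open>2 L (2 d E) - L E\<close>. By slow variation, both are asymptotic to
  \<open>L E = L s / m\<close>, and \<open>g (s x\<^sub>1)\<close> is asymptotic to \<open>s x\<^sub>1 L s\<close>.
\<close>

section \<open>Convex functions with unit elasticity at zero\<close>

lemma eventually_at_right_0_less: "0 < b \<Longrightarrow> \<forall>\<^sub>F s in at_right (0::real). 0 < s \<and> s < b"
  using eventually_at_right_real[of 0 b] by simp

lemma filterlim_times_at_right_0:
  fixes c :: real
  assumes "0 < c"
  shows "filterlim (\<lambda>s. s * c) (at_right 0) (at_right 0)"
proof -
  have "((\<lambda>s. s * c) \<longlongrightarrow> 0 * c) (at_right 0)" by (intro tendsto_intros)
  moreover have "\<forall>\<^sub>F s in at_right 0. 0 < s * c"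
    using eventually_at_right_0_less[OF zero_less_one] assms by (auto elim: eventually_mono)
  ultimately show ?thesis unfolding filterlim_at by (auto elim: eventually_mono)
qed

text \<open>Here \<open>g s\<close> stands for \<open>\<phi> (1 - s)\<close> and \<open>D s\<close>
  for \<open>- \<phi>' (1 - s)\<close>. No differentiability is assumed: a one-sided subgradient
  inequality suffices. The domain omits 1 because \<phi> may be infinite at 0. The condition
  \<open>slope_at_zero\<close> is \<phi>'(1) = 0.\<close>

locale subgradient_generator =
  fixes g D :: "real \<Rightarrow> real"
  assumes convex: "convex_on {0..<1} g"
    and zero: "g 0 = 0"
    and pos: "\<And>s. 0 < s \<Longrightarrow> s < 1 \<Longrightarrow> 0 < g s"
    and slope_at_zero: "((\<lambda>s. g s / s) \<longlongrightarrow> 0) (at_right 0)"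
    and subgradient: "\<And>u s. 0 < u \<Longrightarrow> u \<le> s \<Longrightarrow> s < 1 \<Longrightarrow> g s - g u \<le> (s - u) * D s"
    and elasticity: "((\<lambda>s. s * D s / g s) \<longlongrightarrow> 1) (at_right 0)"
begin

section \<open>Monotonicity, continuity and range of \<open>L\<close> and \<open>g\<close>\<close>

definition L :: "real \<Rightarrow> real" where "L s = g s / s"

lemma g_eq: "0 < s \<Longrightarrow> g s = s * L s"
  by (simp add: L_def)

lemma L_pos: "0 < s \<Longrightarrow> s < 1 \<Longrightarrow> 0 < L s"
  by (simp add: L_def pos)

lemma L_tendsto_0: "(L \<longlongrightarrow> 0) (at_right 0)"
  using slope_at_zero by (simp add: L_def[abs_def])

text \<open>Convexity yields continuity only on the open interval, so the point 0 cannot serve as an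
  endpoint later on. A small \<open>u\<close> with small \<open>L u\<close> takes its place.\<close>

lemma ex_small:
  assumes "0 < v" "0 < b"
  shows "\<exists>u. 0 < u \<and> u < b \<and> L u < v"
proof -
  have "\<forall>\<^sub>F u in at_right 0. L u < v"
    using L_tendsto_0 assms(1) by (rule order_tendstoD)
  moreover have "\<forall>\<^sub>F u in at_right 0. u \<in> {0<..<b}"
    using assms(2) by (rule eventually_at_right_real)
  ultimately have "\<forall>\<^sub>F u in at_right 0. 0 < u \<and> u < b \<and> L u < v"
    by eventually_elim auto
  then show ?thesis
    using eventually_happens'[OF trivial_limit_at_right_real] by blast
qed

text \<open>Convexity cleared of denominators: \<open>l\<close> is the weight of \<open>t\<close>
  when \<open>s\<close> is written as a mean of \<open>u\<close> and \<open>t\<close>. Taking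
  \<open>u = 0\<close> compares \<open>g\<close> with rays through the origin.\<close>

lemma three_points:
  assumes "0 \<le> u" "u < s" "s < t" "t < 1"
  shows "(t - u) * g s \<le> (t - s) * g u + (s - u) * g t"
proof -
  define l where "l = (s - u) / (t - u)"
  have l: "0 \<le> l" "l \<le> 1" and lt: "l * (t - u) = s - u"
    using assms by (auto simp: l_def)
  have "(1 - l) * u + l * t = s" using lt by (simp add: algebra_simps)
  moreover have "g ((1 - l) *\<^sub>R u + l *\<^sub>R t) \<le> (1 - l) * g u + l * g t"
    using assms l by (intro convex_onD[OF convex]) auto
  ultimately have "(t - u) * g s \<le> (t - u) * ((1 - l) * g u + l * g t)"
    using assms by (intro mult_left_mono) auto
  also have "\<dots> = ((t - u) - l * (t - u)) * g u + l * (t - u) * g t"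
    by (simp add: algebra_simps)
  finally show ?thesis unfolding lt by simp
qed

lemma L_mono:
  assumes "0 < s" "s \<le> t" "t < 1"
  shows "L s \<le> L t"
proof (cases "s = t")
  case False
  with assms have "t * g s \<le> s * g t"
    using three_points[of 0 s t] by (simp add: zero)
  then have "t * (s * L s) \<le> s * (t * L t)" using assms by (simp add: g_eq)
  then have "(s * t) * L s \<le> (s * t) * L t" by (simp add: mult_ac)
  then show ?thesis using assms by simp
qed simp

text \<open>If \<open>L\<close> did not increase from \<open>s\<close> to \<open>t\<close>, the
  graph of \<open>g\<close> at \<open>t\<close> would lie on or below the ray of slope
  \<open>L s\<close>. Since \<open>L\<close> tends to 0, some \<open>u < s\<close> lies strictly
  below that ray. The chord from \<open>u\<close> to \<open>t\<close> would then pass strictly below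
  the graph at \<open>s\<close>, against convexity.\<close>

lemma L_strict:
  assumes "0 < s" "s < t" "t < 1"
  shows "L s < L t"
proof (rule ccontr)
  assume "\<not> L s < L t"
  then have eq: "L t \<le> L s" by simp
  obtain u where u: "0 < u" "u < s" "L u < L s"
    using ex_small[of "L s" s] L_pos assms by auto
  have "(t - u) * (s * L s) \<le> (t - s) * (u * L u) + (s - u) * (t * L t)"
    using three_points[of u s t] assms u by (simp add: g_eq)
  also have "\<dots> \<le> (t - s) * (u * L u) + (s - u) * (t * L s)"
    using eq assms u by (intro add_left_mono mult_left_mono) auto
  also have "\<dots> < (t - s) * (u * L s) + (s - u) * (t * L s)"
    using assms u by auto
  also have "\<dots> = (t - u) * (s * L s)" by (simp add: algebra_simps)
  finally show False by simp
qed

lemma L_less_iff: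
  assumes "0 < s" "s < 1" "0 < t" "t < 1"
  shows "L s < L t \<longleftrightarrow> s < t"
proof (cases "s < t")
  case True
  with L_strict assms show ?thesis by blast
next
  case False
  then have "L t \<le> L s" using assms by (intro L_mono) auto
  with False show ?thesis by simp
qed

lemma g_tendsto_0: "(g \<longlongrightarrow> 0) (at_right 0)"
proof (rule Lim_transform_eventually)
  have "((\<lambda>s::real. s * L s) \<longlongrightarrow> 0 * 0) (at_right 0)"
    by (intro tendsto_mult L_tendsto_0 tendsto_ident_at)
  then show "((\<lambda>s::real. s * L s) \<longlongrightarrow> 0) (at_right 0)" by simp
  show "\<forall>\<^sub>F s in at_right 0. s * L s = g s"
    using eventually_at_right_less[of 0] by eventually_elim (simp add: g_eq)
qed

lemma g_strict:
  assumes "0 \<le> s" "s < t" "t < 1"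
  shows "g s < g t"
proof (cases "s = 0")
  case True
  with pos[of t] assms show ?thesis by (simp add: zero)
next
  case False
  then have "0 < s" using assms by simp
  then have "0 < L s" "L s < L t" using L_strict L_pos assms by auto
  then have "s * L s < t * L t"
    using \<open>0 < s\<close> assms by (intro mult_strict_mono) auto
  with \<open>0 < s\<close> assms show ?thesis by (simp add: g_eq)
qed

lemma g_le_iff:
  assumes "0 \<le> s" "s < 1" "0 \<le> t" "t < 1"
  shows "g s \<le> g t \<longleftrightarrow> s \<le> t"
proof (cases "t < s")
  case True
  with g_strict[of t s] assms show ?thesis by simp
next
  case False
  with g_strict[of s t] assms show ?thesis by (cases "s = t") auto
qed

lemma continuous_g: "continuous_on {0<..<1} g"
  by (intro convex_on_continuous convex_on_subset[OF convex]) auto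

lemma continuous_L: "continuous_on {0<..<1} L"
  unfolding L_def[abs_def] by (intro continuous_intros continuous_g) auto

lemma L_surj:
  assumes "0 < v" "v \<le> L t" "0 < t" "t < 1"
  obtains e where "0 < e" "e \<le> t" "L e = v"
proof -
  obtain u where u: "0 < u" "u < t" "L u < v"
    using ex_small[of v t] assms by auto
  have "continuous_on {u..t} L" by (rule continuous_on_subset[OF continuous_L]) (use u assms in auto)
  then obtain e where "u \<le> e" "e \<le> t" "L e = v"
    using IVT'[of L u v t] u assms by auto
  with u show thesis by (intro that) auto
qed

lemma g_surj:
  assumes "0 \<le> v" "v \<le> g t" "0 < t" "t < 1"
  obtains y where "0 \<le> y" "y \<le> t" "g y = v"
proof (cases "v = 0")
  case True
  with that[of 0] zero assms show thesis by auto
next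
  case False
  then obtain u where u: "0 < u" "u < t" "L u < v"
    using ex_small[of v t] assms by auto
  \<comment> \<open>Because \<open>u < 1\<close>, the value \<open>g u\<close> is at most
    \<open>L u\<close>, so it lies below \<open>v\<close>. This gives the intermediate value theorem
    a left endpoint inside the interval of continuity.\<close>
  have "u * L u \<le> 1 * L u" using u assms L_pos[of u] by (intro mult_right_mono) auto
  then have "g u < v" using u by (simp add: g_eq)
  have "continuous_on {u..t} g" by (rule continuous_on_subset[OF continuous_g]) (use u assms in auto)
  then obtain y where "u \<le> y" "y \<le> t" "g y = v"
    using IVT'[of g u v t] u assms \<open>g u < v\<close> by auto
  with u show thesis by (intro that) auto
qed

section \<open>Slow variation of \<open>L\<close>\<close>

lemma L_slow_less:
  assumes "0 < x" "x < 1"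
  shows "((\<lambda>s. L (s * x) / L s) \<longlongrightarrow> 1) (at_right 0)"
proof (rule tendsto_sandwich)
  have "((\<lambda>s. (1 - (1 - x) * (s * D s / g s)) / x) \<longlongrightarrow> (1 - (1 - x) * 1) / x) (at_right 0)"
    using assms by (intro tendsto_intros elasticity) auto
  then show "((\<lambda>s. (1 - (1 - x) * (s * D s / g s)) / x) \<longlongrightarrow> 1) (at_right 0)"
    using assms by simp
  show "\<forall>\<^sub>F s in at_right 0. (1 - (1 - x) * (s * D s / g s)) / x \<le> L (s * x) / L s"
    using eventually_at_right_0_less[OF zero_less_one]
  proof eventually_elim
    case (elim s)
    then have sx: "0 < s * x" "s * x \<le> s" using assms by (auto simp: mult_le_cancel_left1)
    \<comment> \<open>Division by \<open>g s\<close> makes the right-hand side \<open>1 - x\<close>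
      times the elasticity. A further division by \<open>x\<close> turns the ratio of values of
      \<open>g\<close> into a ratio of values of \<open>L\<close>.\<close>
    have "g s - g (s * x) \<le> (s - s * x) * D s" using subgradient[OF sx] elim by simp
    then have "(g s - (s - s * x) * D s) / g s \<le> g (s * x) / g s"
      using pos[of s] elim by (intro divide_right_mono) auto
    moreover have "(g s - (s - s * x) * D s) / g s = 1 - (1 - x) * (s * D s / g s)"
      using pos[of s] elim by (simp add: field_simps)
    ultimately have "1 - (1 - x) * (s * D s / g s) \<le> g (s * x) / g s" by simp
    then have "(1 - (1 - x) * (s * D s / g s)) / x \<le> g (s * x) / g s / x"
      using assms by (intro divide_right_mono) auto
    also have "\<dots> = L (s * x) / L s" using elim assms by (simp add: L_def field_simps)
    finally show ?case .
  qed
  show "\<forall>\<^sub>F s in at_right 0. L (s * x) / L s \<le> 1"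
    using eventually_at_right_0_less[OF zero_less_one]
    by eventually_elim (use assms L_mono L_pos in \<open>auto simp: divide_le_eq_1 mult_le_cancel_left1\<close>)
qed auto

lemma L_slow:
  assumes "0 < x"
  shows "((\<lambda>s. L (s * x) / L s) \<longlongrightarrow> 1) (at_right 0)"
proof -
  consider "x < 1" | "x = 1" | "1 < x" by linarith
  then show ?thesis
  proof cases
    case 1
    with assms show ?thesis by (rule L_slow_less)
  next
    case 2
    have "\<forall>\<^sub>F s in at_right 0. L (s * x) / L s = 1"
      using eventually_at_right_0_less[OF zero_less_one]
    proof eventually_elim
      case (elim s)
      with 2 L_pos[of s] show ?case by simp
    qed
    then show ?thesis by (rule tendsto_eventually)
  next
    case 3
    \<comment> \<open>The case \<open>1 / x < 1\<close> is evaluated at \<open>s * x\<close> instead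
      of \<open>s\<close> and then inverted.\<close>
    have "((\<lambda>s. L (s * (1 / x)) / L s) \<longlongrightarrow> 1) (at_right 0)"
      using 3 by (intro L_slow_less) auto
    then have "((\<lambda>s. L (s * x * (1 / x)) / L (s * x)) \<longlongrightarrow> 1) (at_right 0)"
      using filterlim_times_at_right_0[OF assms] by (rule filterlim_compose)
    then have "((\<lambda>s. inverse (L s / L (s * x))) \<longlongrightarrow> inverse 1) (at_right 0)"
      using 3 by (intro tendsto_inverse) auto
    then show ?thesis by (simp add: inverse_eq_divide)
  qed
qed

section \<open>Solutions \<open>e\<close> of \<open>L (e s) = L s / x\<close>\<close>

lemma eventually_inverse_small:
  assumes "0 < x" "0 < b" "b < 1"
  shows "\<forall>\<^sub>F s in at_right 0. L s / x < L b"
proof -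
  have "((\<lambda>s. L s / x) \<longlongrightarrow> 0 / x) (at_right 0)"
    using assms by (intro tendsto_intros L_tendsto_0) auto
  then show ?thesis using assms L_pos[of b] by (intro order_tendstoD) auto
qed

text \<open>As \<open>L s / x\<close> falls below every \<open>L b\<close>, monotonicity forces
  \<open>e s < b\<close>. The function \<open>e\<close> is described only by its equation, which
  keeps \<eta> out of the analysis. Convergence within \<open>at_right 0\<close> allows composition
  with \<open>L_slow\<close>.\<close>

lemma inverse_tendsto_0:
  assumes x: "0 < x"
    and e: "\<forall>\<^sub>F s in at_right 0. 0 < e s \<and> e s < 1 \<and> L (e s) = L s / x"
  shows "filterlim e (at_right 0) (at_right 0)"
proof -
  have "(e \<longlongrightarrow> 0) (at_right 0)"
  proof (rule order_tendstoI)
    fix a :: real assume "a < 0"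
    then show "\<forall>\<^sub>F s in at_right 0. a < e s" using e by (auto elim: eventually_mono)
  next
    fix a :: real assume a: "0 < a"
    define b where "b = min a (1 / 2)"
    have b: "0 < b" "b < 1" "b \<le> a" using a by (auto simp: b_def)
    from e eventually_inverse_small[OF x b(1,2)] show "\<forall>\<^sub>F s in at_right 0. e s < a"
    proof eventually_elim
      case (elim s)
      then have "e s < b" using L_less_iff[of "e s" b] b by auto
      with b show ?case by simp
    qed
  qed
  then show ?thesis using e unfolding filterlim_at by (auto elim: eventually_mono)
qed

text \<open>For fixed \<open>a\<close>, slow variation makes \<open>L (s / a) / L s\<close> tend to
  1, which is less than \<open>1 / x\<close>. Hence \<open>L (s / a) < L (e s)\<close> eventually,
  and so \<open>s / a < e s\<close>.\<close>

lemma inverse_dominates: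
  assumes x: "0 < x" "x < 1"
    and e: "\<forall>\<^sub>F s in at_right 0. 0 < e s \<and> e s < 1 \<and> L (e s) = L s / x"
  shows "((\<lambda>s. s / e s) \<longlongrightarrow> 0) (at_right 0)"
proof (rule order_tendstoI)
  fix a :: real assume "a < 0"
  show "\<forall>\<^sub>F s in at_right 0. a < s / e s"
    using e eventually_at_right_0_less[OF zero_less_one]
  proof eventually_elim
    case (elim s)
    then have "0 < s / e s" by auto
    with \<open>a < 0\<close> show ?case by linarith
  qed
next
  fix a :: real assume a: "0 < a"
  have "\<forall>\<^sub>F s in at_right 0. L (s * (1 / a)) / L s < 1 / x"
    using a x by (intro order_tendstoD(2)[OF L_slow]) auto
  then show "\<forall>\<^sub>F s in at_right 0. s / e s < a"
    using e eventually_at_right_0_less[OF zero_less_one] eventually_at_right_0_less[OF a]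
  proof eventually_elim
    case (elim s)
    then have "L (s / a) < 1 / x * L s" using L_pos[of s] by (simp add: pos_divide_less_eq)
    with elim have "L (s / a) < L (e s)" by simp
    then have "s / a < e s" using elim a L_less_iff[of "s / a" "e s"] by simp
    with elim a show ?case by (simp add: field_simps)
  qed
qed

section \<open>Increments of \<open>g\<close> at the scale of \<eta>\<close>

lemma increment_bounds:
  assumes E: "0 < E" "E \<le> y" "y < z" "z \<le> c * E" "2 * (c * E) < 1"
  shows "L E * (z - y) \<le> g z - g y" "g z - g y \<le> (2 * L (E * (2 * c)) - L E) * (z - y)"
proof -
  \<comment> \<open>The slope of \<open>g\<close> on \<open>[y, z]\<close> is at least that of the
    chord from 0 to \<open>y\<close>, which is \<open>L y\<close>.\<close>
  have "L E * (z - y) \<le> L y * (z - y)" using assms by (intro mult_right_mono L_mono) auto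
  also have "\<dots> \<le> g z - g y"
  proof -
    have "z * g y \<le> y * g z" using three_points[of 0 y z] assms by (simp add: zero)
    then have "z * (y * L y) \<le> y * g z" using assms by (simp add: g_eq)
    then have "y * (z * L y) \<le> y * g z" by (simp add: mult_ac)
    then have "z * L y \<le> g z" using assms by simp
    then show ?thesis using assms by (simp add: g_eq algebra_simps)
  qed
  finally show "L E * (z - y) \<le> g z - g y" .
  \<comment> \<open>The slope on \<open>[y, z]\<close> is at most that of the chord from
    \<open>z\<close> to \<open>2 * z\<close>, namely \<open>2 * L (2 * z) - L z\<close>. The bound
    on \<open>c * E\<close> keeps \<open>2 * z\<close> below 1.\<close>
  have "(2 * z - y) * g z \<le> z * g y + (z - y) * g (2 * z)"
    using three_points[of y z "2 * z"] assms by simp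
  then have "z * (g z - g y) \<le> (z - y) * (g (2 * z) - g z)" by (simp add: algebra_simps)
  also have "g (2 * z) - g z = z * (2 * L (2 * z) - L z)" using assms by (simp add: L_def field_simps)
  finally have "g z - g y \<le> (2 * L (2 * z) - L z) * (z - y)"
    using assms by (simp add: mult.left_commute mult.commute[of "z - y"])
  also have "\<dots> \<le> (2 * L (E * (2 * c)) - L E) * (z - y)"
  proof (rule mult_right_mono)
    have "L (2 * z) \<le> L (E * (2 * c))" "L E \<le> L z" using assms by (auto intro!: L_mono simp: mult_ac)
    then show "2 * L (2 * z) - L z \<le> 2 * L (E * (2 * c)) - L E" by simp
  qed (use assms in auto)
  finally show "g z - g y \<le> (2 * L (E * (2 * c)) - L E) * (z - y)" .
qed

text \<open>Inserting \<open>L (E s) = L s / m\<close> and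
  \<open>g (s * r) = s * r * L (s * r)\<close> into the two increment bounds squeezes the quotient
  between multiples of \<open>r * m\<close> whose factors tend to 1.\<close>

lemma increment_limit:
  fixes E y z :: "real \<Rightarrow> real"
  assumes r: "0 < r" "r \<le> 1" and m: "0 < m" "m \<le> 1" and c: "0 < c"
    and E: "\<forall>\<^sub>F s in at_right 0. 0 < E s \<and> E s < 1 \<and> L (E s) = L s / m"
    and yz: "\<forall>\<^sub>F s in at_right 0. E s \<le> y s \<and> y s < z s \<and> z s \<le> c * E s
               \<and> g (z s) - g (y s) = g (s * r)"
  shows "((\<lambda>s. (z s - y s) / s) \<longlongrightarrow> r * m) (at_right 0)"
proof -
  have E0: "filterlim E (at_right 0) (at_right 0)"
    using inverse_tendsto_0[OF m(1) E] .
  \<comment> \<open>The constant \<open>2 * c\<close> does not depend on \<open>s\<close> and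
    \<open>E s\<close> tends to 0, so slow variation applies along \<open>E\<close>.\<close>
  have K: "((\<lambda>s. 2 * (L (E s * (2 * c)) / L (E s)) - 1) \<longlongrightarrow> 2 * 1 - 1) (at_right 0)"
    using c by (intro tendsto_intros filterlim_compose[OF L_slow E0]) auto
  have R: "((\<lambda>s. L (s * r) / L s) \<longlongrightarrow> 1) (at_right 0)" using r by (intro L_slow)
  have small: "\<forall>\<^sub>F s in at_right 0. 2 * (c * E s) < 1"
  proof -
    have "\<forall>\<^sub>F s in at_right 0. E s \<in> {0<..<1 / (2 * c)}"
      using E0 eventually_at_right_real[of 0 "1 / (2 * c)"] c by (auto simp: filterlim_iff)
    then show ?thesis by eventually_elim (use c in \<open>auto simp: field_simps\<close>)
  qed
  have upper: "w / s \<le> r * m * (p / l)"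
    if "0 < s" "0 < l" "l / m * w \<le> s * r * p" for s l w p :: real
    using that m by (simp add: field_simps)
  have lower: "r * m * (p / l) \<le> w / s * k"
    if "0 < s" "0 < l" "s * r * p \<le> k * (l / m) * w" for s l w p k :: real
    using that m by (simp add: field_simps)
  have normalize: "2 * b - a = (2 * (b / a) - 1) * a" if "0 < a" for a b :: real
    using that by (simp add: field_simps)
  have K_pos: "\<forall>\<^sub>F s in at_right 0. 0 < 2 * (L (E s * (2 * c)) / L (E s)) - 1"
    using K by (rule order_tendstoD) auto
  show ?thesis
  proof (rule tendsto_sandwich)
    show "\<forall>\<^sub>F s in at_right 0. (z s - y s) / s \<le> r * m * (L (s * r) / L s)"
      using E yz small eventually_at_right_0_less[OF zero_less_one]
    proof eventually_elim
      case (elim s)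
      then have "L (E s) * (z s - y s) \<le> g (s * r)"
        using increment_bounds(1)[of "E s" "y s" "z s" c] by simp
      then have "L s / m * (z s - y s) \<le> s * r * L (s * r)"
        using elim r by (simp add: g_eq)
      then show ?case using upper[of s "L s"] elim m L_pos[of s] by blast
    qed
    show "\<forall>\<^sub>F s in at_right 0. r * m * (L (s * r) / L s) / (2 * (L (E s * (2 * c)) / L (E s)) - 1)
             \<le> (z s - y s) / s"
      using E yz small K_pos eventually_at_right_0_less[OF zero_less_one]
    proof eventually_elim
      case (elim s)
      let ?k = "2 * (L (E s * (2 * c)) / L (E s)) - 1"
      have "g (s * r) \<le> (2 * L (E s * (2 * c)) - L (E s)) * (z s - y s)"
        using increment_bounds(2)[of "E s" "y s" "z s" c] elim by simp
      also have "2 * L (E s * (2 * c)) - L (E s) = ?k * L (E s)"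
        using normalize[of "L (E s)"] L_pos[of "E s"] elim by blast
      also have "L (E s) = L s / m" using elim by blast
      finally have "s * r * L (s * r) \<le> ?k * (L s / m) * (z s - y s)"
        using elim r by (simp add: g_eq)
      then have "r * m * (L (s * r) / L s) \<le> (z s - y s) / s * ?k"
        using lower[of s "L s"] elim m L_pos[of s] by blast
      then show ?case using pos_divide_le_eq[of ?k] elim by blast
    qed
    show "((\<lambda>s. r * m * (L (s * r) / L s)) \<longlongrightarrow> r * m) (at_right 0)"
      by (rule tendsto_eq_intros R refl | simp)+
    show "((\<lambda>s. r * m * (L (s * r) / L s) / (2 * (L (E s * (2 * c)) / L (E s)) - 1))
             \<longlongrightarrow> r * m) (at_right 0)"
      by (rule tendsto_eq_intros R K refl | simp)+
  qed
qed

text \<open>The index \<open>k\<close> of the smallest \<open>x k\<close> has the largest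
  \<open>e k s\<close>. This single scale controls the whole sum and reduces the claim to
  \<open>increment_limit\<close> with \<open>m = x k\<close>.\<close>

lemma sum_increment_limit:
  fixes x :: "'i \<Rightarrow> real" and e :: "'i \<Rightarrow> real \<Rightarrow> real" and y z :: "real \<Rightarrow> real"
  assumes J: "finite J" "J \<noteq> {}"
    and r: "0 < r" "r \<le> 1" and x: "\<And>j. j \<in> J \<Longrightarrow> 0 < x j \<and> x j \<le> 1"
    and e: "\<And>j. j \<in> J \<Longrightarrow> \<forall>\<^sub>F s in at_right 0. 0 < e j s \<and> e j s < 1 \<and> L (e j s) = L s / x j"
    and y: "\<forall>\<^sub>F s in at_right 0. 0 \<le> y s \<and> y s < 1 \<and> g (y s) = (\<Sum>j\<in>J. g (e j s))"
    and z: "\<forall>\<^sub>F s in at_right 0. 0 \<le> z s \<and> z s < 1 \<and> g (z s) = g (s * r) + (\<Sum>j\<in>J. g (e j s))"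
  shows "((\<lambda>s. (z s - y s) / s) \<longlongrightarrow> r * Min (x ` J)) (at_right 0)"
proof -
  obtain k where k: "k \<in> J" and k_min: "x k = Min (x ` J)"
  proof -
    have "Min (x ` J) \<in> x ` J" using J by (intro Min_in) auto
    then show thesis using that by (metis imageE)
  qed
  \<comment> \<open>One unit for each summand \<open>g (e j s)\<close> and one more for
    \<open>g (s * r)\<close>; each of these is at most \<open>g (e k s)\<close>.\<close>
  define c where "c = real (card J + 1)"
  have c: "1 \<le> c" by (simp add: c_def)
  have e_all: "\<forall>\<^sub>F s in at_right 0. \<forall>j\<in>J. 0 < e j s \<and> e j s < 1 \<and> L (e j s) = L s / x j"
    using e J by (simp add: eventually_ball_finite)
  have e0: "filterlim (e k) (at_right 0) (at_right 0)"
    using x[OF k] e[OF k] by (intro inverse_tendsto_0[of "x k"]) auto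
  have small: "\<forall>\<^sub>F s in at_right 0. c * e k s < 1"
  proof -
    have "\<forall>\<^sub>F s in at_right 0. e k s \<in> {0<..<1 / c}"
      using e0 eventually_at_right_real[of 0 "1 / c"] c by (auto simp: filterlim_iff)
    then show ?thesis by eventually_elim (use c in \<open>auto simp: field_simps\<close>)
  qed
  have "((\<lambda>s. (z s - y s) / s) \<longlongrightarrow> r * x k) (at_right 0)"
  proof (rule increment_limit[where E = "e k" and c = c])
    show "\<forall>\<^sub>F s in at_right 0. e k s \<le> y s \<and> y s < z s \<and> z s \<le> c * e k s
               \<and> g (z s) - g (y s) = g (s * r)"
      using e_all y z small eventually_at_right_0_less[OF zero_less_one]
    proof eventually_elim
      case (elim s)
      let ?S = "\<Sum>j\<in>J. g (e j s)"
      have le: "e j s \<le> e k s" if "j \<in> J" for j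
      proof -
        have "x k \<le> x j" using that k_min J by simp
        then have "L (e j s) \<le> L (e k s)"
          using elim that k x L_pos[of s] by (auto intro!: divide_left_mono)
        then show ?thesis using L_less_iff[of "e k s" "e j s"] elim that k by force
      qed
      \<comment> \<open>As \<open>x k\<close> is at most 1, \<open>e k s\<close> also dominates
        \<open>s\<close>, and hence \<open>s * r\<close>.\<close>
      have "L s \<le> L (e k s)"
        using elim x k L_pos[of s] by (simp add: pos_le_divide_eq mult_left_le)
      then have "s \<le> e k s" using L_less_iff[of "e k s" s] elim k by force
      have r': "0 < s * r" "s * r \<le> s" using elim r by (auto simp: mult_le_cancel_left1)
      have "s * r \<le> e k s" "s * r < 1" "e k s < 1"
        using r'(2) \<open>s \<le> e k s\<close> elim k by (linarith | blast)+
      then have b: "0 < g (s * r)" "g (s * r) \<le> g (e k s)"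
        using r' pos[of "s * r"] g_le_iff[of "s * r" "e k s"] by auto
      have "g (e k s) \<le> ?S"
        using J k elim by (intro member_le_sum) (auto intro: less_imp_le pos)
      then have "e k s \<le> y s" using elim k g_le_iff[of "e k s" "y s"] by auto
      have "y s < z s" using elim b g_le_iff[of "z s" "y s"] by auto
      have "?S \<le> real (card J) * g (e k s)"
        using elim k le by (intro sum_bounded_above) (auto simp: g_le_iff less_imp_le)
      \<comment> \<open>Since \<open>L\<close> is non-decreasing and \<open>c\<close> is at least 1,
        \<open>c * g (e k s)\<close> is at most \<open>g (c * e k s)\<close>. A bound on
        \<open>g (z s)\<close> thereby becomes one on \<open>z s\<close>.\<close>
      then have "g (z s) \<le> c * g (e k s)" using elim b by (simp add: c_def algebra_simps)
      also have "\<dots> = c * e k s * L (e k s)" using elim k by (simp add: g_eq)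
      also have "\<dots> \<le> c * e k s * L (c * e k s)"
        using elim k c by (intro mult_left_mono L_mono) (auto simp: mult_le_cancel_right1)
      also have "\<dots> = g (c * e k s)" using elim k c by (simp add: g_eq)
      finally have "z s \<le> c * e k s" using elim k c g_le_iff[of "z s" "c * e k s"] by auto
      with \<open>e k s \<le> y s\<close> \<open>y s < z s\<close> elim show ?case by simp
    qed
  qed (use r x[OF k] e[OF k] c in auto)
  with k_min show ?thesis by simp
qed

end


section \<open>Archimedean copulas and their generators\<close>

lemma has_df_on_unit_cubeD:
  assumes "has_df_on_unit_cube M d U C" "\<And>i. i \<in> {1..d} \<Longrightarrow> u i \<in> {0..1}"
  shows "\<P>(\<omega> in M. \<forall>i\<in>{1..d}. U i \<omega> \<le> u i) = C u"
  using assms unfolding has_df_on_unit_cube_def by blast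

lemma is_copula_margin:
  assumes d: "1 \<le> d" and cop: "is_copula d C" and u: "u \<in> {0..1}"
  shows "C (\<lambda>i. if i = 1 then u else 1) = u"
proof -
  obtain \<mu> :: "(nat \<Rightarrow> real) measure" where
    "prob_space \<mu>"
    and marg: "\<And>i. i \<in> {1..d} \<Longrightarrow> distr \<mu> borel (\<lambda>x. x i) = uniform_measure lborel {0<..<1}"
    and df: "has_df_on_unit_cube \<mu> d (\<lambda>i x. x i) C"
    using cop unfolding is_copula_def by auto
  interpret prob_space \<mu> by fact
  have meas [measurable]: "(\<lambda>x. x i) \<in> borel_measurable \<mu>" if "i \<in> {1..d}" for i
    using df that unfolding has_df_on_unit_cube_def by auto
  have meas1: "(\<lambda>x. x 1) \<in> borel_measurable \<mu>" using meas[of 1] d by simp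
  have margin: "\<P>(x in \<mu>. x i \<le> a) = a" if i: "i \<in> {1..d}" and a: "a \<in> {0..1}" for i a
  proof -
    have "\<P>(x in \<mu>. x i \<le> a) = measure (distr \<mu> borel (\<lambda>x. x i)) {..a}"
      using meas[OF i] by (subst measure_distr) (auto intro!: arg_cong[where f = prob])
    also have "\<dots> = measure lborel ({0<..<1} \<inter> {..a}) / measure lborel {0<..<1::real}"
      unfolding marg[OF i] by (rule measure_uniform_measure) auto
    \<comment> \<open>The uniform law lives on an open interval, hence the separate case
      \<open>a = 1\<close>.\<close>
    also have "{0<..<1} \<inter> {..a} = (if a = 1 then {0<..<1} else {0<..a})"
      using a by auto
    finally show ?thesis using a by (simp split: if_splits)
  qed
  have le1: "AE x in \<mu>. \<forall>i\<in>{1..d}. x i \<le> 1"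
  proof (rule AE_finite_allI)
    fix i assume "i \<in> {1..d}"
    with meas[OF this] margin[of i 1] show "AE x in \<mu>. x i \<le> 1"
      by (subst prob_Collect_eq_1[symmetric]) auto
  qed simp
  let ?v = "\<lambda>i::nat. if i = 1 then u else 1"
  have "C ?v = \<P>(x in \<mu>. \<forall>i\<in>{1..d}. x i \<le> ?v i)"
    by (rule has_df_on_unit_cubeD[OF df, symmetric]) (use u in auto)
  also have "\<dots> = \<P>(x in \<mu>. x 1 \<le> u)"
  proof (rule prob_eq_AE)
    show "AE x in \<mu>. (\<forall>i\<in>{1..d}. x i \<le> ?v i) \<longleftrightarrow> x 1 \<le> u"
      using le1 by eventually_elim (use d in auto)
    show "{x \<in> space \<mu>. x 1 \<le> u} \<in> events" using meas1 by measurable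
    show "{x \<in> space \<mu>. \<forall>i\<in>{1..d}. x i \<le> ?v i} \<in> events"
      using meas by (intro sets.sets_Collect_finite_All) auto
  qed
  also have "\<dots> = u" using margin[of 1] d u by simp
  finally show ?thesis .
qed

text \<open>At \<open>(u, 1, ..., 1)\<close> the sum of generators collapses to
  \<open>\<phi> u\<close>. Finiteness and positivity of \<phi> are drawn from this left-inverse
  identity.\<close>

lemma copula_generator_inverse:
  assumes "1 \<le> d" "is_copula d (archimedean_copula d \<phi>)" "\<phi> 1 = 0" "u \<in> {0..1}"
  shows "generator_inverse \<phi> (\<phi> u) = u"
proof -
  have "(\<Sum>i\<in>{1..d}. \<phi> (if i = 1 then u else 1)) = (\<Sum>i\<in>{1..d}. if i = 1 then \<phi> u else 0)"
    using assms(3) by (intro sum.cong) auto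
  also have "\<dots> = \<phi> u" using assms(1) by (simp add: sum.delta)
  finally show ?thesis
    using is_copula_margin[OF assms(1,2,4)] by (simp add: archimedean_copula_def)
qed

text \<open>The event in the numerator is, up to a null set, a difference of two boxes whose
  probabilities are values of the copula. The denominator is \<open>s\<close> by uniformity of the
  first margin.\<close>

lemma archimedean_cond_prob:
  fixes U :: "nat \<Rightarrow> 'a \<Rightarrow> real"
  assumes d: "1 \<le> d" and "prob_space M"
    and df: "has_df_on_unit_cube M d U (archimedean_copula d \<phi>)"
    and gi: "\<And>u. u \<in> {0..1} \<Longrightarrow> generator_inverse \<phi> (\<phi> u) = u"
    and "\<phi> 1 = 0"
    and s: "0 < s" "s \<le> 1" and a: "1 - s \<le> a" "a \<le> 1"
    and v: "\<And>j. j \<in> {2..d} \<Longrightarrow> v j \<in> {0..1}"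
  shows "\<P>(\<omega> in M. a < U 1 \<omega> \<and> (\<forall>j\<in>{2..d}. U j \<omega> \<le> v j) \<bar> 1 - s < U 1 \<omega>)
    = (generator_inverse \<phi> (\<Sum>j\<in>{2..d}. \<phi> (v j))
       - generator_inverse \<phi> (\<phi> a + (\<Sum>j\<in>{2..d}. \<phi> (v j)))) / s"
proof -
  interpret prob_space M by fact
  have meas: "U i \<in> borel_measurable M" if "i \<in> {1..d}" for i
    using df that unfolding has_df_on_unit_cube_def by auto
  have meas1 [measurable]: "U 1 \<in> borel_measurable M" using meas[of 1] d by simp
  have d_split: "{1..d} = insert 1 {2..d}" using d by auto
  define R where "R b w = {\<omega> \<in> space M. U 1 \<omega> \<le> b \<and> (\<forall>j\<in>{2..d}. U j \<omega> \<le> w j)}"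
    for b :: real and w :: "nat \<Rightarrow> real"
  have R_sets: "R b w \<in> events" for b w
  proof -
    have "{\<omega> \<in> space M. \<forall>j\<in>{2..d}. U j \<omega> \<le> w j} \<in> events"
      using meas by (intro sets.sets_Collect_finite_All) auto
    moreover have "{\<omega> \<in> space M. U 1 \<omega> \<le> b} \<in> events" by measurable
    ultimately show ?thesis unfolding R_def by (rule sets.sets_Collect_conj)
  qed
  have R_prob: "prob (R b w) = generator_inverse \<phi> (\<phi> b + (\<Sum>j\<in>{2..d}. \<phi> (w j)))"
    if "b \<in> {0..1}" "\<And>j. j \<in> {2..d} \<Longrightarrow> w j \<in> {0..1}" for b w
  proof -
    let ?u = "\<lambda>i. if i = 1 then b else w i"
    have "prob (R b w) = \<P>(\<omega> in M. \<forall>i\<in>{1..d}. U i \<omega> \<le> ?u i)"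
      unfolding R_def d_split by (rule arg_cong[where f = prob]) auto
    also have "\<dots> = archimedean_copula d \<phi> ?u"
      by (rule has_df_on_unit_cubeD[OF df]) (use that d_split in auto)
    also have "\<dots> = generator_inverse \<phi> (\<phi> b + (\<Sum>j\<in>{2..d}. \<phi> (w j)))"
    proof -
      have "(\<Sum>i\<in>{2..d}. \<phi> (?u i)) = (\<Sum>j\<in>{2..d}. \<phi> (w j))" by (intro sum.cong) auto
      then show ?thesis unfolding archimedean_copula_def d_split by (subst sum.insert) auto
    qed
    finally show ?thesis .
  qed
  have ones: "prob (R b (\<lambda>_. 1)) = b" if "b \<in> {0..1}" for b
    using that R_prob[of b "\<lambda>_. 1"] gi[OF that] \<open>\<phi> 1 = 0\<close> by simp
  \<comment> \<open>The box at \<open>(1, ..., 1)\<close> has probability 1. This removes the upper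
    bound on \<open>U 1\<close> that the difference of boxes carries.\<close>
  have le1: "AE \<omega> in M. \<omega> \<in> R 1 (\<lambda>_. 1)"
    using ones[of 1] R_sets by (subst prob_eq_1[symmetric]) auto
  have split: "prob {\<omega> \<in> space M. b < U 1 \<omega> \<and> (\<forall>j\<in>{2..d}. U j \<omega> \<le> w j)}
      = prob (R 1 w) - prob (R b w)" if "b \<le> 1" for b w
  proof -
    have "prob (R 1 w) - prob (R b w) = prob (R 1 w - R b w)"
      using that R_sets by (intro finite_measure_Diff[symmetric]) (auto simp: R_def)
    also have "\<dots> = prob {\<omega> \<in> space M. b < U 1 \<omega> \<and> (\<forall>j\<in>{2..d}. U j \<omega> \<le> w j)}"
    proof (rule finite_measure_eq_AE)
      show "AE \<omega> in M. \<omega> \<in> R 1 w - R b w \<longleftrightarrow>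
          \<omega> \<in> {\<omega> \<in> space M. b < U 1 \<omega> \<and> (\<forall>j\<in>{2..d}. U j \<omega> \<le> w j)}"
        using le1 by eventually_elim (auto simp: R_def)
      have "{\<omega> \<in> space M. \<forall>j\<in>{2..d}. U j \<omega> \<le> w j} \<in> events"
        using meas by (intro sets.sets_Collect_finite_All) auto
      moreover have "{\<omega> \<in> space M. b < U 1 \<omega>} \<in> events" by measurable
      ultimately show "{\<omega> \<in> space M. b < U 1 \<omega> \<and> (\<forall>j\<in>{2..d}. U j \<omega> \<le> w j)} \<in> events"
        by (rule sets.sets_Collect_conj)
    qed (use R_sets in auto)
    finally show ?thesis by simp
  qed
  have "\<P>(\<omega> in M. 1 - s < U 1 \<omega>)
      = prob {\<omega> \<in> space M. 1 - s < U 1 \<omega> \<and> (\<forall>j\<in>{2..d}. U j \<omega> \<le> 1)}"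
  proof (rule finite_measure_eq_AE)
    show "AE \<omega> in M. \<omega> \<in> {\<omega> \<in> space M. 1 - s < U 1 \<omega>} \<longleftrightarrow>
        \<omega> \<in> {\<omega> \<in> space M. 1 - s < U 1 \<omega> \<and> (\<forall>j\<in>{2..d}. U j \<omega> \<le> 1)}"
      using le1 by eventually_elim (auto simp: R_def)
    show 1: "{\<omega> \<in> space M. 1 - s < U 1 \<omega>} \<in> events" by measurable
    have "{\<omega> \<in> space M. \<forall>j\<in>{2..d}. U j \<omega> \<le> 1} \<in> events"
      using meas by (intro sets.sets_Collect_finite_All) auto
    with 1 show "{\<omega> \<in> space M. 1 - s < U 1 \<omega> \<and> (\<forall>j\<in>{2..d}. U j \<omega> \<le> 1)} \<in> events"
      by (rule sets.sets_Collect_conj[rotated])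
  qed
  also have "\<dots> = s"
    using split[of "1 - s" "\<lambda>_. 1"] ones[of 1] ones[of "1 - s"] s by simp
  finally have den: "\<P>(\<omega> in M. 1 - s < U 1 \<omega>) = s" .
  \<comment> \<open>The conditioning event is implied because \<open>a\<close> is at least
    \<open>1 - s\<close>.\<close>
  have "{\<omega> \<in> space M. (a < U 1 \<omega> \<and> (\<forall>j\<in>{2..d}. U j \<omega> \<le> v j)) \<and> 1 - s < U 1 \<omega>}
      = {\<omega> \<in> space M. a < U 1 \<omega> \<and> (\<forall>j\<in>{2..d}. U j \<omega> \<le> v j)}"
    using a by auto
  then have num: "\<P>(\<omega> in M. (a < U 1 \<omega> \<and> (\<forall>j\<in>{2..d}. U j \<omega> \<le> v j)) \<and> 1 - s < U 1 \<omega>)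
      = prob (R 1 v) - prob (R a v)"
    using split[of a v] a by simp
  show ?thesis
    unfolding cond_prob_def den num
    using R_prob[of 1 v] R_prob[of a v] v a s \<open>\<phi> 1 = 0\<close> by simp
qed

section \<open>Finiteness, convexity and subgradients of the generator\<close>

lemma generator_finite_pos:
  assumes gi: "\<And>u. u \<in> {0..1} \<Longrightarrow> generator_inverse \<phi> (\<phi> u) = u"
    and one: "\<phi> 1 = 0" and u: "0 < u" "u \<le> 1"
  shows "\<phi> u < \<infinity>" and "u < 1 \<Longrightarrow> 0 < \<phi> u"
proof -
  \<comment> \<open>The generalized inverse sends \<infinity> to 0 and 0 to 1. By \<open>gi\<close>,
    an infinite value at \<open>u\<close> would force \<open>u = 0\<close>, and a zero value would
    force \<open>u = 1\<close>.\<close>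
  have "generator_inverse \<phi> \<infinity> = 0"
  proof -
    have "{t \<in> {0..1}. \<phi> t \<le> \<infinity>} = {0..1}" by auto
    then show ?thesis by (simp only: generator_inverse_def) simp
  qed
  then show "\<phi> u < \<infinity>" using gi[of u] u by (cases "\<phi> u = \<infinity>") (auto simp: less_top)
  have "generator_inverse \<phi> 0 = 1" using gi[of 1] one by simp
  then show "0 < \<phi> u" if "u < 1" using gi[of u] u that by (auto simp: zero_less_iff_neq_zero)
qed

lemma archimedean_generator_convexD:
  assumes "archimedean_generator \<phi>" "x \<in> {0..1}" "y \<in> {0..1}" "t \<in> {0..1}"
  shows "\<phi> ((1 - t) * x + t * y) \<le> ennreal (1 - t) * \<phi> x + ennreal t * \<phi> y"
  using assms unfolding archimedean_generator_def by blast

lemma generator_convex_on: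
  assumes "archimedean_generator \<phi>"
    and fin: "\<And>u. 0 < u \<Longrightarrow> u \<le> 1 \<Longrightarrow> \<phi> u < \<infinity>"
  shows "convex_on {0..<1} (\<lambda>s. enn2real (\<phi> (1 - s)))"
proof (rule convex_onI)
  fix t x y :: real
  assume t: "0 < t" "t < 1" and xy: "x \<in> {0..<1}" "y \<in> {0..<1}"
  have "\<phi> ((1 - t) * (1 - x) + t * (1 - y))
      \<le> ennreal (1 - t) * \<phi> (1 - x) + ennreal t * \<phi> (1 - y)"
    by (rule archimedean_generator_convexD[OF assms(1)]) (use t xy in auto)
  moreover have "(1 - t) * (1 - x) + t * (1 - y) = 1 - ((1 - t) *\<^sub>R x + t *\<^sub>R y)"
    by (simp add: algebra_simps)
  moreover obtain p where "0 \<le> p" "\<phi> (1 - x) = ennreal p"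
    using fin[of "1 - x"] xy by (cases "\<phi> (1 - x)") auto
  moreover obtain q where "0 \<le> q" "\<phi> (1 - y) = ennreal q"
    using fin[of "1 - y"] xy by (cases "\<phi> (1 - y)") auto
  ultimately have "\<phi> (1 - ((1 - t) *\<^sub>R x + t *\<^sub>R y)) \<le> ennreal ((1 - t) * p + t * q)"
    using t by (simp add: ennreal_mult' ennreal_plus)
  then have "enn2real (\<phi> (1 - ((1 - t) *\<^sub>R x + t *\<^sub>R y))) \<le> (1 - t) * p + t * q"
    using t \<open>0 \<le> p\<close> \<open>0 \<le> q\<close> by (intro enn2real_leI) auto
  then show "enn2real (\<phi> (1 - ((1 - t) *\<^sub>R x + t *\<^sub>R y)))
      \<le> (1 - t) * enn2real (\<phi> (1 - x)) + t * enn2real (\<phi> (1 - y))"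
    using \<open>\<phi> (1 - x) = ennreal p\<close> \<open>\<phi> (1 - y) = ennreal q\<close> \<open>0 \<le> p\<close> \<open>0 \<le> q\<close> by simp
qed auto

text \<open>On \<open>[1 - s, 1 - u]\<close> the non-decreasing \<phi>' is at least its value at the
  left endpoint; integration gives the bound.\<close>

lemma generator_subgradient:
  assumes "generator_derivative \<phi> \<phi>'" and us: "0 < u" "u \<le> s" "s < 1"
  shows "enn2real (\<phi> (1 - s)) - enn2real (\<phi> (1 - u)) \<le> (s - u) * - \<phi>' (1 - s)"
proof -
  have mono: "mono_on {0<..<1} \<phi>'"
    and int: "set_integrable lborel {1 - s..1 - u} \<phi>'"
    and eq: "(LBINT t:{1 - s..1 - u}. \<phi>' t) = enn2real (\<phi> (1 - u)) - enn2real (\<phi> (1 - s))"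
    using assms unfolding generator_derivative_def by auto
  have "(LBINT t:{1 - s..1 - u}. \<phi>' (1 - s)) \<le> (LBINT t:{1 - s..1 - u}. \<phi>' t)"
  proof (rule set_integral_mono[OF _ int])
    show "set_integrable lborel {1 - s..1 - u} (\<lambda>t. \<phi>' (1 - s))"
      by (rule borel_integrable_atLeastAtMost') simp
    fix t assume "t \<in> {1 - s..1 - u}"
    with us show "\<phi>' (1 - s) \<le> \<phi>' t" by (intro mono_onD[OF mono]) auto
  qed
  moreover have "(LBINT t:{1 - s..1 - u}. \<phi>' (1 - s)) = (s - u) * \<phi>' (1 - s)"
    using us by (simp add: set_lebesgue_integral_def)
  ultimately show ?thesis unfolding eq by simp
qed

section \<open>Transfer from \<open>g\<close> and \<open>L\<close> to \<phi>, \<open>ell\<close> and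
  \<open>eta\<close>\<close>

theorem theorem4p5:
  fixes d :: nat
    and \<phi> :: "real \<Rightarrow> ennreal"
    and \<phi>' :: "real \<Rightarrow> real"
    and M :: "'a measure"
    and U :: "nat \<Rightarrow> 'a \<Rightarrow> real"
  assumes "d \<ge> 2"
    and "archimedean_generator \<phi>"
    and "is_copula d (archimedean_copula d \<phi>)"
    and "prob_space M"
    and "has_df_on_unit_cube M d U (archimedean_copula d \<phi>)"
    and "generator_derivative \<phi> \<phi>'"
    and "\<phi>' 1 = 0"
    and "((\<lambda>s. - (s * \<phi>' (1 - s) / enn2real (\<phi> (1 - s)))) \<longlongrightarrow> 1) (at_right 0)"
  shows "strict_mono_on {0<..1} (ell \<phi>)
    \<and> slowly_varying_at_zero (\<lambda>s. enn2real (ell \<phi> s))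
    \<and> (\<forall>x>0. \<forall>\<^sub>F s in at_right 0. ell \<phi> s / ennreal x \<in> ell \<phi> ` {0<..1})
    \<and> (\<forall>x :: nat \<Rightarrow> real. (\<forall>i\<in>{1..d}. x i \<in> {0<..1}) \<longrightarrow>
         ((\<lambda>s. \<P>(\<omega> in M. U 1 \<omega> > 1 - s * x 1 \<and> (\<forall>j\<in>{2..d}. U j \<omega> \<le> 1 - eta \<phi> s (x j))
                  \<bar> U 1 \<omega> > 1 - s))
           \<longlongrightarrow> x 1 * Min (x ` {2..d})) (at_right 0))
    \<and> (\<forall>x>0. ((\<lambda>s. eta \<phi> s x) \<longlongrightarrow> 0) (at_right 0))
    \<and> (\<forall>x. 0 < x \<and> x < 1 \<longrightarrow> ((\<lambda>s. s / eta \<phi> s x) \<longlongrightarrow> 0) (at_right 0))"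
proof -
  have one: "\<phi> 1 = 0" using assms(2) by (simp add: archimedean_generator_def)
  have d1: "1 \<le> d" using assms(1) by simp
  have gi: "generator_inverse \<phi> (\<phi> u) = u" if "u \<in> {0..1}" for u
    using copula_generator_inverse[OF d1 assms(3) one that] .
  note fin = generator_finite_pos(1)[OF gi one] and phi_pos = generator_finite_pos(2)[OF gi one]
  define g where "g = (\<lambda>s. enn2real (\<phi> (1 - s)))"
  have phi_g: "\<phi> (1 - s) = ennreal (g s)" if "0 \<le> s" "s < 1" for s
    using fin[of "1 - s"] that by (simp add: g_def)
  interpret G: subgradient_generator g "\<lambda>s. - \<phi>' (1 - s)"
  proof
    show "convex_on {0..<1} g" unfolding g_def by (rule generator_convex_on[OF assms(2) fin])
    show "g 0 = 0" by (simp add: g_def one)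
    show "0 < g s" if "0 < s" "s < 1" for s
      using phi_pos[of "1 - s"] fin[of "1 - s"] that by (simp add: g_def enn2real_positive_iff)
    show "((\<lambda>s. g s / s) \<longlongrightarrow> 0) (at_right 0)"
      using assms(6,7) unfolding generator_derivative_def g_def by simp
    show "g s - g u \<le> (s - u) * - \<phi>' (1 - s)" if "0 < u" "u \<le> s" "s < 1" for u s
      unfolding g_def by (rule generator_subgradient[OF assms(6) that])
    show "((\<lambda>s. s * - \<phi>' (1 - s) / g s) \<longlongrightarrow> 1) (at_right 0)"
      using assms(8) by (simp add: g_def)
  qed
  have ell: "ell \<phi> s = ennreal (G.L s)" if "0 < s" "s < 1" for s
    using that G.pos[of s] by (simp add: ell_def G.L_def phi_g divide_ennreal)
  \<comment> \<open>The point 1 lies outside the locale, and \<open>ell \<phi> 1 = \<phi> 0\<close>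
    may be infinite. Convexity between 1 and 0 gives \<open>ell \<phi> t \<le> \<phi> 0\<close>; a
    \<open>t\<close> strictly between \<open>s\<close> and 1 makes the inequality strict.\<close>
  have ell_less_1: "ell \<phi> s < ell \<phi> 1" if s: "0 < s" "s < 1" for s
  proof -
    obtain t where t: "s < t" "t < 1" using dense[OF s(2)] by auto
    have "\<phi> ((1 - t) * 1 + t * 0) \<le> ennreal (1 - t) * \<phi> 1 + ennreal t * \<phi> 0"
      by (rule archimedean_generator_convexD[OF assms(2)]) (use s t in auto)
    then have "\<phi> (1 - t) \<le> \<phi> 0 * ennreal t" by (simp add: one mult.commute)
    then have "ell \<phi> t \<le> \<phi> 0 * ennreal t / ennreal t"
      unfolding ell_def by (rule divide_right_mono_ennreal)
    also have "\<dots> = \<phi> 0" using s t by (intro ennreal_mult_divide_eq) auto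
    also have "\<phi> 0 = ell \<phi> 1" by (simp add: ell_def divide_ennreal_def)
    finally have "ennreal (G.L t) \<le> ell \<phi> 1" using s t by (simp add: ell)
    moreover have "ennreal (G.L s) < ennreal (G.L t)"
      using G.L_strict[of s t] G.L_pos[of s] s t by (intro ennreal_lessI) auto
    ultimately show ?thesis using s by (simp add: ell)
  qed
  have ell_mono: "strict_mono_on {0<..1} (ell \<phi>)"
  proof (rule strict_mono_onI)
    fix s t :: real assume st: "s \<in> {0<..1}" "t \<in> {0<..1}" "s < t"
    show "ell \<phi> s < ell \<phi> t"
    proof (cases "t = 1")
      case True with st ell_less_1 show ?thesis by auto
    next
      case False
      with st G.L_strict[of s t] G.L_pos[of t] show ?thesis by (auto simp: ell intro!: ennreal_lessI)
    qed
  qed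
  then have inj: "inj_on (ell \<phi>) {0<..1}" by (rule strict_mono_on_imp_inj_on)

  have eta: "\<forall>\<^sub>F s in at_right 0. ell \<phi> s / ennreal x \<in> ell \<phi> ` {0<..1} \<and>
      0 < eta \<phi> s x \<and> eta \<phi> s x < 1 \<and> G.L (eta \<phi> s x) = G.L s / x" if x: "0 < x" for x
  proof -
    \<comment> \<open>The choice 1/2 is an arbitrary level inside (0,1): once \<open>L s / x\<close>
      is below \<open>L (1 / 2)\<close>, it is a value of \<open>L\<close>, and injectivity of
      \<open>ell\<close> identifies its preimage with \<open>eta\<close>.\<close>
    have half: "0 < (1 / 2 :: real)" "(1 / 2 :: real) < 1" by auto
    show ?thesis
      using G.eventually_inverse_small[OF x half] eventually_at_right_0_less[OF zero_less_one]
    proof eventually_elim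
      case (elim s)
      then have "0 < G.L s / x" using x G.L_pos[of s] by simp
      then obtain e where e: "0 < e" "e \<le> 1 / 2" "G.L e = G.L s / x"
        using G.L_surj[of "G.L s / x" "1 / 2"] elim half by auto
      then have *: "ell \<phi> s / ennreal x = ell \<phi> e"
        using elim x G.L_pos[of s] by (simp add: ell divide_ennreal)
      moreover have "eta \<phi> s x = e"
        unfolding eta_def * by (rule the_inv_into_f_f[OF inj]) (use e in auto)
      ultimately show ?case using e by auto
    qed
  qed
  have eta_L: "\<forall>\<^sub>F s in at_right 0. 0 < eta \<phi> s x \<and> eta \<phi> s x < 1 \<and> G.L (eta \<phi> s x) = G.L s / x"
    if "0 < x" for x
    using eta[OF that] by (rule eventually_mono) auto
  have eta_0: "filterlim (\<lambda>s. eta \<phi> s x) (at_right 0) (at_right 0)" if "0 < x" for x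
    by (rule G.inverse_tendsto_0[OF that eta_L[OF that]])

  have slow: "slowly_varying_at_zero (\<lambda>s. enn2real (ell \<phi> s))"
    unfolding slowly_varying_at_zero_def
  proof (intro conjI exI[of _ 1] allI impI ballI)
    show "0 < enn2real (ell \<phi> s)" if "s \<in> {0<..<1}" for s
      using that G.L_pos[of s] by (simp add: ell)
    have "continuous_on {0<..<1} (\<lambda>s. enn2real (ell \<phi> s))"
      by (rule continuous_on_eq[OF G.continuous_L]) (use G.L_pos in \<open>auto simp: ell less_imp_le\<close>)
    then show "(\<lambda>s. enn2real (ell \<phi> s)) \<in> borel_measurable (restrict_space borel {0<..<1})"
      by (rule borel_measurable_continuous_on_restrict)
    fix x :: real assume x: "0 < x"
    then have "0 < 1 / x" by simp
    from eventually_at_right_0_less[OF this] eventually_at_right_0_less[OF zero_less_one]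
    have "\<forall>\<^sub>F s in at_right 0. G.L (s * x) / G.L s = enn2real (ell \<phi> (s * x)) / enn2real (ell \<phi> s)"
    proof eventually_elim
      case (elim s)
      then have "0 < s * x" "s * x < 1" using x by (auto simp: field_simps)
      with elim G.L_pos[of s] G.L_pos[of "s * x"] show ?case by (simp add: ell less_imp_le)
    qed
    with G.L_slow[OF x]
    show "((\<lambda>s. enn2real (ell \<phi> (s * x)) / enn2real (ell \<phi> s)) \<longlongrightarrow> 1) (at_right 0)"
      by (rule Lim_transform_eventually)
  qed simp

  \<comment> \<open>The generalized inverse is known only on values of \<phi>. Any \<open>v\<close>
    up to \<open>g (1 / 2)\<close> is such a value by \<open>g_surj\<close>.\<close>
  have inverse_g: "0 \<le> 1 - generator_inverse \<phi> (ennreal v) \<and> 1 - generator_inverse \<phi> (ennreal v) < 1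
      \<and> g (1 - generator_inverse \<phi> (ennreal v)) = v" if v: "0 \<le> v" "v \<le> g (1 / 2)" for v
  proof -
    obtain y where y: "0 \<le> y" "y \<le> 1 / 2" "g y = v"
      using G.g_surj[of v "1 / 2"] v by auto
    then have "generator_inverse \<phi> (ennreal v) = 1 - y"
      using gi[of "1 - y"] phi_g[of y] by simp
    with y show ?thesis by simp
  qed

  have limit: "((\<lambda>s. \<P>(\<omega> in M. U 1 \<omega> > 1 - s * x 1 \<and> (\<forall>j\<in>{2..d}. U j \<omega> \<le> 1 - eta \<phi> s (x j))
                  \<bar> U 1 \<omega> > 1 - s))
           \<longlongrightarrow> x 1 * Min (x ` {2..d})) (at_right 0)"
    if x: "\<forall>i\<in>{1..d}. x i \<in> {0<..1}" for x :: "nat \<Rightarrow> real"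
  proof -
    have x1: "0 < x 1" "x 1 \<le> 1" using x d1 by auto
    have xj: "0 < x j \<and> x j \<le> 1" if "j \<in> {2..d}" for j using x that by auto
    define a where "a s = (\<Sum>j\<in>{2..d}. g (eta \<phi> s (x j)))" for s
    \<comment> \<open>\<open>1 - y s\<close> and \<open>1 - z s\<close> are the copula values of the
      two boxes, so the conditional probability is \<open>(z s - y s) / s\<close>.\<close>
    define y where "y s = 1 - generator_inverse \<phi> (ennreal (a s))" for s
    define z where "z s = 1 - generator_inverse \<phi> (ennreal (g (s * x 1) + a s))" for s
    have eta_all: "\<forall>\<^sub>F s in at_right 0. \<forall>j\<in>{2..d}. 0 < eta \<phi> s (x j) \<and> eta \<phi> s (x j) < 1"
    proof (intro eventually_ball_finite ballI)
      fix j assume "j \<in> {2..d}"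
      with xj have "0 < x j" by blast
      from eta_L[OF this] show "\<forall>\<^sub>F s in at_right 0. 0 < eta \<phi> s (x j) \<and> eta \<phi> s (x j) < 1"
        by (rule eventually_mono) blast
    qed simp
    have g_nonneg: "0 \<le> g s" for s by (simp add: g_def)
    have a_nonneg: "0 \<le> a s" for s unfolding a_def by (intro sum_nonneg g_nonneg)
    \<comment> \<open>Both arguments of the generalized inverse must eventually enter the range
      covered by \<open>inverse_g\<close>.\<close>
    have "((\<lambda>s. g (s * x 1) + a s) \<longlongrightarrow> 0 + (\<Sum>j\<in>{2..d}. 0)) (at_right 0)"
      unfolding a_def using x1 xj
      by (intro tendsto_add tendsto_sum filterlim_compose[OF G.g_tendsto_0]
          filterlim_times_at_right_0 eta_0) auto
    then have "\<forall>\<^sub>F s in at_right 0. g (s * x 1) + a s < g (1 / 2)"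
      using G.pos[of "1 / 2"] by (intro order_tendstoD) auto
    then have small: "\<forall>\<^sub>F s in at_right 0. 0 \<le> a s \<and> a s \<le> g (1 / 2)
        \<and> 0 \<le> g (s * x 1) + a s \<and> g (s * x 1) + a s \<le> g (1 / 2)"
    proof eventually_elim
      case (elim s)
      with a_nonneg[of s] g_nonneg[of "s * x 1"] show ?case by linarith
    qed
    have "((\<lambda>s. (z s - y s) / s) \<longlongrightarrow> x 1 * Min (x ` {2..d})) (at_right 0)"
    proof (rule G.sum_increment_limit)
      show "\<forall>\<^sub>F s in at_right 0. 0 \<le> y s \<and> y s < 1 \<and> g (y s) = (\<Sum>j\<in>{2..d}. g (eta \<phi> s (x j)))"
        using small unfolding y_def a_def[symmetric] by eventually_elim (use inverse_g in blast)
      show "\<forall>\<^sub>F s in at_right 0. 0 \<le> z s \<and> z s < 1 \<and>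
          g (z s) = g (s * x 1) + (\<Sum>j\<in>{2..d}. g (eta \<phi> s (x j)))"
        using small unfolding z_def a_def[symmetric] by eventually_elim (use inverse_g in blast)
    qed (use assms(1) x1 xj eta_L in auto)
    moreover have "\<forall>\<^sub>F s in at_right 0. (z s - y s) / s =
        \<P>(\<omega> in M. U 1 \<omega> > 1 - s * x 1 \<and> (\<forall>j\<in>{2..d}. U j \<omega> \<le> 1 - eta \<phi> s (x j)) \<bar> U 1 \<omega> > 1 - s)"
      using eventually_at_right_0_less[OF zero_less_one] eta_all
    proof eventually_elim
      case (elim s)
      have sx: "0 < s * x 1" "s * x 1 \<le> s" using x1 elim by (auto simp: mult_le_cancel_left1)
      have "(\<Sum>j\<in>{2..d}. \<phi> (1 - eta \<phi> s (x j))) = (\<Sum>j\<in>{2..d}. ennreal (g (eta \<phi> s (x j))))"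
        using elim by (intro sum.cong refl phi_g) (auto simp: less_imp_le)
      also have "\<dots> = ennreal (a s)" unfolding a_def using g_nonneg by (intro sum_ennreal)
      finally have A: "(\<Sum>j\<in>{2..d}. \<phi> (1 - eta \<phi> s (x j))) = ennreal (a s)" .
      have B: "\<phi> (1 - s * x 1) + ennreal (a s) = ennreal (g (s * x 1) + a s)"
      proof -
        have "s * x 1 < 1" using sx elim by linarith
        then show ?thesis
          using phi_g[of "s * x 1"] sx g_nonneg a_nonneg by (simp add: ennreal_plus)
      qed
      have "\<P>(\<omega> in M. U 1 \<omega> > 1 - s * x 1 \<and> (\<forall>j\<in>{2..d}. U j \<omega> \<le> 1 - eta \<phi> s (x j)) \<bar> U 1 \<omega> > 1 - s)
          = (generator_inverse \<phi> (\<Sum>j\<in>{2..d}. \<phi> (1 - eta \<phi> s (x j)))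
             - generator_inverse \<phi> (\<phi> (1 - s * x 1) + (\<Sum>j\<in>{2..d}. \<phi> (1 - eta \<phi> s (x j))))) / s"
        by (rule archimedean_cond_prob[OF d1 assms(4,5) gi one]) (use elim sx in \<open>auto simp: less_imp_le\<close>)
      also have "\<dots> = (z s - y s) / s" unfolding A B y_def z_def by simp
      finally show ?case by simp
    qed
    ultimately show ?thesis by (rule Lim_transform_eventually)
  qed

  show ?thesis
  proof (intro conjI allI impI)
    show "\<forall>\<^sub>F s in at_right 0. ell \<phi> s / ennreal x \<in> ell \<phi> ` {0<..1}" if "0 < x" for x
      using eta[OF that] by (rule eventually_mono) auto
    show "((\<lambda>s. eta \<phi> s x) \<longlongrightarrow> 0) (at_right 0)" if "0 < x" for x
      using eta_0[OF that] by (simp add: filterlim_at)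
    show "((\<lambda>s. s / eta \<phi> s x) \<longlongrightarrow> 0) (at_right 0)" if "0 < x \<and> x < 1" for x
      using that G.inverse_dominates[OF _ _ eta_L] by blast
  qed (fact ell_mono slow | use limit in blast)+
qed

end
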